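(* Suppose there are $N\geq 1$ coins, exactly one of which is fake, and it is not known whether the fake coin is heavier or lighter than the genuine ones. Two balance scales can be used in parallel. For $N = 2$ the fake coin cannot be identified in any number of minutes. For $N\ne 2$ and every integer $n\ge 2$, the minimum number of minutes in which the fake coin can be guaranteed to be found is exactly $n$ if and only if $$\frac{5^{n-1}-3}{2} < N \le \frac{5^n-3}{2}.$$
   Context: All genuine coins have the same weight; exactly one coin is fake, and it is either lighter or heavier than a genuine coin. The task is only to find the fake coin, not to decide whether it is lighter or heavier. There are two two-pan balance scales usable simultaneously. In each minute each scale may be used for one weighing; in a given minute each coin is placed on at most one pan of at most one scale, and each weighing puts the same number of coins on its two pans. Each weighing reports that the pans balance, or which pan is lighter. Strategies may be adaptive: the weighings in a minute may depend on all results from earlier minutes. Only the $N$ given coins are available; no additional coins known to be genuine are provided. *)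

theory Defs
  imports Complex_Main
begin

text \<open>
  Coins are the numbers \<open>c < N\<close>. A placement assigns to every coin a single location,
  so no coin lies on more than one pan. A scale with two empty pans counts as unused;
  it always reports balance.
\<close>

datatype scale = ScaleA | ScaleB

datatype side = Left | Right

datatype location = Off | On scale side

type_synonym placement = "nat \<Rightarrow> location"

definition pan :: "nat \<Rightarrow> placement \<Rightarrow> scale \<Rightarrow> side \<Rightarrow> nat set" where
  "pan N p s d = {c. c < N \<and> p c = On s d}"

definition legal_placement :: "nat \<Rightarrow> placement \<Rightarrow> bool" where
  "legal_placement N p \<longleftrightarrow> (\<forall>s. card (pan N p s Left) = card (pan N p s Right))"

datatype reading = Balanced | Lighter side

definition reading_of :: "nat \<Rightarrow> (nat \<Rightarrow> real) \<Rightarrow> placement \<Rightarrow> scale \<Rightarrow> reading" where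
  "reading_of N w p s =
     (let l = (\<Sum>c\<in>pan N p s Left. w c); r = (\<Sum>c\<in>pan N p s Right. w c)
      in if l < r then Lighter Left else if r < l then Lighter Right else Balanced)"

text \<open>
  A history lists, minute by minute and oldest first, the readings of the two scales.
  An adaptive strategy chooses the next placement from the history alone.
\<close>

type_synonym history = "(scale \<Rightarrow> reading) list"

type_synonym strategy = "history \<Rightarrow> placement"

primrec run :: "nat \<Rightarrow> strategy \<Rightarrow> (nat \<Rightarrow> real) \<Rightarrow> nat \<Rightarrow> history" where
  "run N \<sigma> w 0 = []"
| "run N \<sigma> w (Suc m) = run N \<sigma> w m @ [reading_of N w (\<sigma> (run N \<sigma> w m))]"

definition coin_weights :: "nat \<Rightarrow> real \<Rightarrow> real \<Rightarrow> nat \<Rightarrow> real" where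
  "coin_weights f a b c = (if c = f then b else a)"

text \<open>
  The fake coin \<open>f\<close>, the genuine weight \<open>a\<close> and the fake weight \<open>b\<close> are all unknown to the
  weigher: neither \<open>\<sigma>\<close> nor the final guess \<open>g\<close> may depend on them except through the history.
  Since scales may stay unused, a strategy that stops early is covered by padding it with
  empty placements, so this says that at most \<open>n\<close> minutes suffice. For the same reason it is
  harmless to demand legal placements on histories that never occur.
\<close>

definition can_find_within :: "nat \<Rightarrow> nat \<Rightarrow> bool" where
  "can_find_within N n \<longleftrightarrow>
     (\<exists>(\<sigma> :: strategy) (g :: history \<Rightarrow> nat).
        (\<forall>h. legal_placement N (\<sigma> h)) \<and>
        (\<forall>f<N. \<forall>a b. a > 0 \<and> b > 0 \<and> a \<noteq> b \<longrightarrow>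
           g (run N \<sigma> (coin_weights f a b) n) = f))"

definition min_minutes :: "nat \<Rightarrow> nat \<Rightarrow> bool" where
  "min_minutes N n \<longleftrightarrow> can_find_within N n \<and> (\<forall>m<n. \<not> can_find_within N m)"

end

theory Submission
  imports Defs
begin

text \<open>
  In one minute the two scales produce only five readings, not nine, since the fake coin lies on
  at most one of them: both balance, or one of the four pans rises. If the fake coin is light,
  the rising pan is its own; if it is heavy, it is the opposite pan. What is known at any
  moment is therefore a pair of sets: the coins \<open>L\<close> that may be light fakes and
  the coins \<open>H\<close> that may be heavy fakes. A strategy is a five-way branching
  decision tree on such pairs (\<open>can_find_within_iff_solvable\<close>).

  Few coins can be handled because the leaves are few. A coin that may deviate in either direction
  uses two leaves, unless it never meets a scale, and this happens to at most one coin. So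
  \<open>k\<close> minutes resolve at most \<open>5 ^ k\<close> suspects of known direction and at most
  \<open>(5 ^ k + 1) / 2\<close> coins of unknown direction (\<open>solvable_card_le\<close>). The first
  weighing loses a little more, because no genuine coin is available yet: each scale
  carries an even number of unknown coins, and when it tilts each of them becomes a suspect in
  one direction, so with \<open>k\<close> minutes left it carries at most the even number
  \<open>5 ^ k - 1\<close>. The sum is \<open>2 * (5 ^ k - 1) + (5 ^ k + 1) / 2 = (5 ^ (k + 1) - 3) / 2\<close>
  (\<open>solvable_all_le\<close>).

  Conversely, each of these bounds can be attained. Suspects of known direction are
  put on the pans in pairs of the same direction, which keeps the pans equally full and sends
  one coin of the pair to each of the two tilting outcomes; one genuine coin settles the odd case
  (\<open>solvable_disjoint\<close>). Unknown coins can be distributed freely over the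
  scales once each scale has a genuine coin for parity (\<open>solvable_unknown\<close>), and
  after the first weighing genuine coins exist (\<open>solvable_all\<close>).

  For two coins a light one and a heavy other one are the same physical situation, so nothing
  distinguishes them.
\<close>

section \<open>Decision trees\<close>

text \<open>
  If a heavy fake lies at \<open>x\<close>, the scales react as if a light fake lay at the mirror image
  of \<open>x\<close>. This lets a location also serve as a name for one of the five joint readings of
  the scales, namely the reading that a light fake at this location causes; the function
  \<open>signal\<close> below gives the actual reading.
\<close>

primrec mirror :: "location \<Rightarrow> location" where
  "mirror Off = Off"
| "mirror (On s d) = On s (case d of Left \<Rightarrow> Right | Right \<Rightarrow> Left)"

primrec signal :: "location \<Rightarrow> scale \<Rightarrow> reading" where
  "signal Off = (\<lambda>t. Balanced)"
| "signal (On s d) = (\<lambda>t. if t = s then Lighter d else Balanced)"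

text \<open>
  A decision tree of depth \<open>k\<close> that identifies the fake coin, knowing that it is a light coin
  of \<open>L\<close> or a heavy coin of \<open>H\<close>. At a leaf only one coin may be left, but its
  direction may still be open, so the two sets may share it.
\<close>

primrec solvable :: "nat \<Rightarrow> nat \<Rightarrow> nat set \<Rightarrow> nat set \<Rightarrow> bool" where
  "solvable N 0 L H \<longleftrightarrow> (\<exists>c. L \<union> H \<subseteq> {c})"
| "solvable N (Suc k) L H \<longleftrightarrow>
     (\<exists>p. legal_placement N p \<and>
        (\<forall>x. solvable N k {c \<in> L. p c = x} {c \<in> H. p c = mirror x}))"

lemma mirror_mirror [simp]: "mirror (mirror x) = x"
  by (cases x) (auto split: side.splits)

lemma inj_signal: "inj signal"
proof (rule injI)
  fix x y assume eq: "signal x = signal y"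
  then have "\<And>t. signal x t = signal y t" by simp
  from this[of ScaleA] this[of ScaleB] show "x = y"
    by (cases x; cases y) (auto split: if_splits, (metis scale.exhaust)+)
qed

lemma location_disj:
  "x = Off \<or> x = On ScaleA Left \<or> x = On ScaleA Right \<or>
     x = On ScaleB Left \<or> x = On ScaleB Right"
proof (cases x)
  case (On s d)
  then show ?thesis by (cases s; cases d) simp_all
qed simp

lemma all_location_iff:
  "(\<forall>x. P x) \<longleftrightarrow> P Off \<and> P (On ScaleA Left) \<and> P (On ScaleA Right) \<and>
     P (On ScaleB Left) \<and> P (On ScaleB Right)"
  (is "_ \<longleftrightarrow> ?each")
proof
  assume each: ?each
  show "\<forall>x. P x"
  proof
    fix x show "P x" using location_disj[of x] each by (elim disjE) simp_all
  qed
qed simp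

lemma reading_of_coin_weights:
  assumes "f < N" and legal: "legal_placement N p" and "a \<noteq> b"
  shows "reading_of N (coin_weights f a b) p = signal (if b < a then p f else mirror (p f))"
proof
  fix s
  have weight: "(\<Sum>c\<in>pan N p s d. coin_weights f a b c) =
      a * card (pan N p s d) + (if p f = On s d then b - a else 0)" for d
  proof -
    have fin: "finite (pan N p s d)" by (simp add: pan_def)
    have "(\<Sum>c\<in>pan N p s d. coin_weights f a b c) =
        (\<Sum>c\<in>pan N p s d. a + (if c = f then b - a else 0))"
      by (intro sum.cong) (auto simp: coin_weights_def)
    also have "\<dots> = a * card (pan N p s d) + (if f \<in> pan N p s d then b - a else 0)"
      using fin by (simp add: sum.distrib)
    also have "f \<in> pan N p s d \<longleftrightarrow> p f = On s d"
      using \<open>f < N\<close> by (simp add: pan_def)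
    finally show ?thesis .
  qed
  have "card (pan N p s Left) = card (pan N p s Right)"
    using legal by (simp add: legal_placement_def)
  moreover have "d = Left \<or> d = Right" for d by (cases d) auto
  ultimately show "reading_of N (coin_weights f a b) p s =
      signal (if b < a then p f else mirror (p f)) s"
    using \<open>a \<noteq> b\<close> unfolding reading_of_def Let_def weight
    by (cases "p f") (auto split: side.splits)
qed

text \<open>
  The given recursion extends a history at its end. A decision tree is built from its root, so
  the first minute has to be split off instead; what remains is a run of the strategy that
  prefixes the first reading to its history.
\<close>

lemma run_Suc_front:
  "run N \<sigma> w (Suc m) =
     reading_of N w (\<sigma> []) # run N (\<lambda>h. \<sigma> (reading_of N w (\<sigma> []) # h)) w m"
  by (induction m) simp_all

lemma solvable_if_strategy:
  assumes "\<And>h. legal_placement N (\<sigma> h)"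
    and "L \<subseteq> {..<N}" and "H \<subseteq> {..<N}"
    and "\<And>c. c \<in> L \<Longrightarrow> g (run N \<sigma> (coin_weights c 2 1) k) = c"
    and "\<And>c. c \<in> H \<Longrightarrow> g (run N \<sigma> (coin_weights c 1 2) k) = c"
  shows "solvable N k L H"
  using assms
proof (induction k arbitrary: \<sigma> g L H)
  case 0
  then have "L \<union> H \<subseteq> {g []}" by auto
  then show ?case by auto
next
  case (Suc k)
  let ?p = "\<sigma> []"
  have "solvable N k {c \<in> L. ?p c = x} {c \<in> H. ?p c = mirror x}" for x
  proof (rule Suc.IH[of "\<lambda>h. \<sigma> (signal x # h)" _ _ "\<lambda>h. g (signal x # h)"])
    fix c assume c: "c \<in> {c \<in> L. ?p c = x}"
    then have "reading_of N (coin_weights c 2 1) ?p = signal x"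
      using reading_of_coin_weights[of c N ?p 2 1] Suc.prems(1,2) by auto
    then show "g (signal x # run N (\<lambda>h. \<sigma> (signal x # h)) (coin_weights c 2 1) k) = c"
      using Suc.prems(4)[of c] c by (simp add: run_Suc_front del: run.simps)
  next
    fix c assume c: "c \<in> {c \<in> H. ?p c = mirror x}"
    then have "reading_of N (coin_weights c 1 2) ?p = signal x"
      using reading_of_coin_weights[of c N ?p 1 2] Suc.prems(1,3) by auto
    then show "g (signal x # run N (\<lambda>h. \<sigma> (signal x # h)) (coin_weights c 1 2) k) = c"
      using Suc.prems(5)[of c] c by (simp add: run_Suc_front del: run.simps)
  qed (use Suc.prems in auto)
  with Suc.prems(1) show ?case by auto
qed

text \<open>
  Strategies and guesses for the five subtrees are glued together: the first reading selects the
  subtree. The gluing is possible because distinct locations cause distinct signals.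
\<close>

lemma strategy_if_solvable:
  assumes "solvable N k L H"
  shows "\<exists>\<sigma> g. (\<forall>h. legal_placement N (\<sigma> h)) \<and>
    (\<forall>f<N. \<forall>a b. a \<noteq> b \<and> (if b < a then f \<in> L else f \<in> H) \<longrightarrow>
       g (run N \<sigma> (coin_weights f a b) k) = f)"
  using assms
proof (induction k arbitrary: L H)
  case 0
  then obtain c where "L \<union> H \<subseteq> {c}" by auto
  moreover have "legal_placement N (\<lambda>_. Off)"
    by (simp add: legal_placement_def pan_def)
  ultimately show ?case
    by (intro exI[of _ "\<lambda>_ _. Off"] exI[of _ "\<lambda>_. c"]) (auto split: if_splits)
next
  case (Suc k)
  then obtain p where legal: "legal_placement N p"
    and sub: "\<And>x. solvable N k {c \<in> L. p c = x} {c \<in> H. p c = mirror x}"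
    by auto
  define wins where "wins x \<sigma> g \<longleftrightarrow> (\<forall>h. legal_placement N (\<sigma> h)) \<and>
    (\<forall>f<N. \<forall>a b. a \<noteq> b \<and>
        (if b < a then f \<in> {c \<in> L. p c = x} else f \<in> {c \<in> H. p c = mirror x}) \<longrightarrow>
       g (run N \<sigma> (coin_weights f a b) k) = f)" for x \<sigma> g
  have "\<forall>x. \<exists>\<sigma> g. wins x \<sigma> g"
    unfolding wins_def by (intro allI Suc.IH sub)
  then obtain \<sigma> g where wins: "\<And>x. wins x (\<sigma> x) (g x)" by metis
  have legal': "legal_placement N (\<sigma> x h)" for x h
    using wins[of x] unfolding wins_def by blast
  have correct: "g x (run N (\<sigma> x) (coin_weights f a b) k) = f"
    if "f < N" "a \<noteq> b"
      "if b < a then f \<in> {c \<in> L. p c = x} else f \<in> {c \<in> H. p c = mirror x}" for x f a b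
    using wins[of x] that unfolding wins_def by blast
  \<comment> \<open>A reading that is not a signal never occurs; \<open>inv\<close> then picks some subtree, which still yields a legal placement.\<close>
  define \<tau> where
    "\<tau> h = (case h of [] \<Rightarrow> p | r # h' \<Rightarrow> \<sigma> (inv signal r) h')" for h
  define e where
    "e h = (case h of [] \<Rightarrow> 0 | r # h' \<Rightarrow> g (inv signal r) h')" for h
  have "e (run N \<tau> (coin_weights f a b) (Suc k)) = f"
    if "f < N" "a \<noteq> b" "if b < a then f \<in> L else f \<in> H" for f a b
  proof -
    define x where "x = (if b < a then p f else mirror (p f))"
    have "reading_of N (coin_weights f a b) (\<tau> []) = signal x"
      using reading_of_coin_weights[OF that(1) legal that(2)] by (simp add: \<tau>_def x_def)
    moreover have "(\<lambda>h. \<tau> (signal x # h)) = \<sigma> x"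
      using inj_signal by (simp add: \<tau>_def fun_eq_iff)
    ultimately have "e (run N \<tau> (coin_weights f a b) (Suc k)) =
        g x (run N (\<sigma> x) (coin_weights f a b) k)"
      using inj_signal by (simp add: run_Suc_front e_def del: run.simps)
    also have "\<dots> = f"
      using that by (intro correct) (auto simp: x_def)
    finally show ?thesis .
  qed
  moreover have "legal_placement N (\<tau> h)" for h
    using legal legal' by (simp add: \<tau>_def split: list.split)
  ultimately show ?case by blast
qed

lemma can_find_within_iff_solvable:
  "can_find_within N n \<longleftrightarrow> solvable N n {..<N} {..<N}"
proof
  assume "can_find_within N n"
  then obtain \<sigma> g where "\<And>h. legal_placement N (\<sigma> h)"
    and "\<And>f a b. \<lbrakk>f < N; a > 0; b > 0; a \<noteq> b\<rbrakk> \<Longrightarrow> g (run N \<sigma> (coin_weights f a b) n) = f"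
    unfolding can_find_within_def by blast
  then show "solvable N n {..<N} {..<N}"
    by (intro solvable_if_strategy[of N \<sigma> _ _ g]) auto
next
  assume "solvable N n {..<N} {..<N}"
  from strategy_if_solvable[OF this] show "can_find_within N n"
    unfolding can_find_within_def by (simp split: if_splits) blast
qed

section \<open>Counting leaves\<close>

lemma card_by_location:
  assumes "finite A"
  shows "card A = card {c \<in> A. p c = Off} +
     card {c \<in> A. p c = On ScaleA Left} + card {c \<in> A. p c = On ScaleA Right} +
     card {c \<in> A. p c = On ScaleB Left} + card {c \<in> A. p c = On ScaleB Right}"
  using assms
proof (induction A)
  case (insert a A)
  have step: "card {c \<in> insert a A. p c = x} =
      card {c \<in> A. p c = x} + (if p a = x then 1 else 0)" for x
  proof -
    have "{c \<in> insert a A. p c = x} =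
        (if p a = x then insert a {c \<in> A. p c = x} else {c \<in> A. p c = x})"
      by auto
    then show ?thesis using insert.hyps by simp
  qed
  from location_disj[of "p a"] show ?case
    unfolding step using insert by (elim disjE) simp_all
qed simp

text \<open>
  At a leaf at most one coin remains, possibly in both directions. The extra unit for a
  coin that is still open in both directions is inherited only by the branch in which both scales
  balance: if a pan rises, a coin on this pan can only be light, and one on the opposite pan
  only heavy.
\<close>

lemma solvable_card_le:
  assumes "solvable N k L H" and "finite L" and "finite H"
  shows "card L + card H \<le> 5 ^ k + (if L \<inter> H = {} then 0 else 1)"
  using assms
proof (induction k arbitrary: L H)
  case 0
  then obtain c where c: "L \<union> H \<subseteq> {c}" by auto
  then have "L = {} \<or> L = {c}" and "H = {} \<or> H = {c}" by auto
  then show ?case by auto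
next
  case (Suc k)
  then obtain p where
    sub: "\<And>x. solvable N k {c \<in> L. p c = x} {c \<in> H. p c = mirror x}"
    by auto
  have bound: "card {c \<in> L. p c = x} + card {c \<in> H. p c = mirror x} \<le> 5 ^ k +
      (if {c \<in> L. p c = x} \<inter> {c \<in> H. p c = mirror x} = {} then 0 else 1)" for x
    using Suc.IH[OF sub] Suc.prems by simp
  have on: "card {c \<in> L. p c = On s d} + card {c \<in> H. p c = mirror (On s d)} \<le> 5 ^ k" for s d
  proof -
    have "{c \<in> L. p c = On s d} \<inter> {c \<in> H. p c = mirror (On s d)} = {}"
      by (cases d) auto
    then show ?thesis using bound[of "On s d"] by simp
  qed
  have off: "card {c \<in> L. p c = Off} + card {c \<in> H. p c = Off} \<le>
      5 ^ k + (if L \<inter> H = {} then 0 else 1)"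
    using bound[of Off] by (auto split: if_splits)
  show ?case
    using off on[of ScaleA Left] on[of ScaleA Right] on[of ScaleB Left] on[of ScaleB Right]
      card_by_location[OF \<open>finite L\<close>, of p] card_by_location[OF \<open>finite H\<close>, of p]
    by simp
qed

text \<open>
  At the start both sets contain all coins. The two pans of a scale hold equally many coins, so the
  branch in which the scale tilts receives an even number of suspects, while its capacity
  \<open>5 ^ k\<close> is odd. One unit is lost for each of the four tilting branches.
\<close>

lemma solvable_all_le:
  assumes "solvable N (Suc k) {..<N} {..<N}"
  shows "2 * N + 3 \<le> 5 ^ Suc k"
proof -
  from assms obtain p where legal: "legal_placement N p"
    and sub: "\<And>x. solvable N k {c \<in> {..<N}. p c = x} {c \<in> {..<N}. p c = mirror x}"
    by auto
  have pan: "{c. c < N \<and> p c = On s d} = pan N p s d" for s d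
    by (auto simp: pan_def)
  have even: "card (pan N p s Right) = card (pan N p s Left)" for s
    using legal by (simp add: legal_placement_def)
  have on: "2 * card (pan N p s Left) + 1 \<le> 5 ^ k" for s
  proof -
    have "pan N p s Left \<inter> pan N p s Right = {}" "finite (pan N p s d)" for d
      by (auto simp: pan_def)
    then have "2 * card (pan N p s Left) \<le> 5 ^ k"
      using solvable_card_le[OF sub[of "On s Left"]] by (simp add: pan even)
    moreover have "odd (5 ^ k :: nat)" by simp
    ultimately show ?thesis by (metis Suc_eq_plus1 dvd_triv_left le_neq_implies_less less_eq_Suc_le)
  qed
  have off: "2 * card {c \<in> {..<N}. p c = Off} \<le> 5 ^ k + 1"
    using solvable_card_le[OF sub[of Off]] by (simp split: if_splits)
  show ?thesis
    using card_by_location[of "{..<N}" p] on[of ScaleA] on[of ScaleB] off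
    by (simp add: pan even)
qed

section \<open>Constructing weighings\<close>

text \<open>
  One step of a decision tree, described by the contents \<open>A1\<close>, \<open>A2\<close> of the left and
  right pans of the first scale and \<open>B1\<close>, \<open>B2\<close> of those of the second. If
  \<open>A1\<close> rises, its coins can only be light and those of \<open>A2\<close> only heavy.
\<close>

lemma solvable_by_pans:
  assumes "A1 \<union> A2 \<union> B1 \<union> B2 \<subseteq> {..<N}"
    and "A1 \<inter> A2 = {}" and "B1 \<inter> B2 = {}" and "(A1 \<union> A2) \<inter> (B1 \<union> B2) = {}"
    and "card A1 = card A2" and "card B1 = card B2"
    and "solvable N k (L \<inter> A1) (H \<inter> A2)" and "solvable N k (L \<inter> A2) (H \<inter> A1)"
    and "solvable N k (L \<inter> B1) (H \<inter> B2)" and "solvable N k (L \<inter> B2) (H \<inter> B1)"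
    and "solvable N k (L - (A1 \<union> A2 \<union> B1 \<union> B2)) (H - (A1 \<union> A2 \<union> B1 \<union> B2))"
  shows "solvable N (Suc k) L H"
proof -
  define p where "p c = (if c \<in> A1 then On ScaleA Left else if c \<in> A2 then On ScaleA Right
    else if c \<in> B1 then On ScaleB Left else if c \<in> B2 then On ScaleB Right else Off)" for c
  have loc: "p c = On ScaleA Left \<longleftrightarrow> c \<in> A1" "p c = On ScaleA Right \<longleftrightarrow> c \<in> A2"
    "p c = On ScaleB Left \<longleftrightarrow> c \<in> B1" "p c = On ScaleB Right \<longleftrightarrow> c \<in> B2"
    "p c = Off \<longleftrightarrow> c \<notin> A1 \<union> A2 \<union> B1 \<union> B2" for c
    using assms(2-4) by (auto simp: p_def)
  have "pan N p ScaleA Left = A1" "pan N p ScaleA Right = A2"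
    "pan N p ScaleB Left = B1" "pan N p ScaleB Right = B2"
    using assms(1) by (auto simp: pan_def loc)
  then have "legal_placement N p"
    using assms(5,6) unfolding legal_placement_def by (metis scale.exhaust)
  moreover have "\<forall>x. solvable N k {c \<in> L. p c = x} {c \<in> H. p c = mirror x}"
    unfolding all_location_iff
    using assms(7-11) by (simp add: loc Collect_conj_eq set_diff_eq)
  ultimately show ?thesis unfolding solvable.simps by blast
qed

lemma solvable_singleton:
  assumes "L \<union> H \<subseteq> {c}"
  shows "solvable N k L H"
  using assms
proof (induction k arbitrary: L H)
  case 0
  then show ?case unfolding solvable.simps by (rule exI)
next
  case (Suc k)
  have "solvable N k L H" using Suc.prems by (rule Suc.IH)
  moreover have "solvable N k {} {}" by (rule Suc.IH) simp
  ultimately show ?case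
    by (intro solvable_by_pans[of "{}" "{}" "{}" "{}"]) simp_all
qed

text \<open>
  As long as three coins are left, two of them are suspected of the same direction; one of these
  goes on each pan. Hence the pans become equally full and also agree in the number of light
  suspects. It takes three coins to guarantee such a pair, so at least one coin
  stays off the pans, whence the strict inequality.
\<close>

lemma exists_balanced_pair:
  fixes L :: "nat set"
  assumes "finite T" and "2 * m < card T"
  shows "\<exists>X Y. X \<subseteq> T \<and> Y \<subseteq> T \<and> X \<inter> Y = {} \<and> card X = m \<and> card Y = m \<and>
    card (X \<inter> L) = card (Y \<inter> L)"
  using assms(2)
proof (induction m)
  case 0
  show ?case by (intro exI[of _ "{}"]) simp
next
  case (Suc m)
  then obtain X Y where XY: "X \<subseteq> T" "Y \<subseteq> T" "X \<inter> Y = {}" "card X = m" "card Y = m"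
    "card (X \<inter> L) = card (Y \<inter> L)"
    by auto
  have fin: "finite X" "finite Y" using XY \<open>finite T\<close> finite_subset by blast+
  have "card (T - (X \<union> Y)) = card T - 2 * m"
    using XY fin by (simp add: card_Diff_subset card_Un_disjoint)
  then have "3 \<le> card (T - (X \<union> Y))" using Suc.prems by simp
  then obtain R where R: "R \<subseteq> T - (X \<union> Y)" "card R = 3"
    by (metis obtain_subset_with_card_n)
  then obtain x y z where xyz: "R = {x, y, z}" "x \<noteq> y" "y \<noteq> z" "x \<noteq> z"
    unfolding card_3_iff by blast
  \<comment> \<open>Two of the three lie on the same side of the partition of \<open>T\<close> by \<open>L\<close>.\<close>
  have "(x \<in> L \<longleftrightarrow> y \<in> L) \<or> (y \<in> L \<longleftrightarrow> z \<in> L) \<or> (x \<in> L \<longleftrightarrow> z \<in> L)" by blast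
  moreover have "x \<in> R" "y \<in> R" "z \<in> R" using xyz(1) by simp_all
  ultimately obtain u v where uv: "u \<in> R" "v \<in> R" "u \<noteq> v" "u \<in> L \<longleftrightarrow> v \<in> L"
    using xyz(2-4) by blast
  then have notin: "u \<notin> X" "u \<notin> Y" "v \<notin> X" "v \<notin> Y" "u \<in> T" "v \<in> T" using R by auto
  show ?case
  proof (intro exI conjI)
    show "card (insert u X \<inter> L) = card (insert v Y \<inter> L)"
      using uv notin fin XY by (auto simp: Int_insert_left)
  qed (use uv notin fin XY in auto)
qed

text \<open>
  If \<open>X\<close> rises, the suspects that remain are the light ones on \<open>X\<close> and the heavy ones
  on \<open>Y\<close>. When both pans carry equally many light suspects, these are as many as the coins
  on one pan, so the two tilts of the scale are equally informative.
\<close>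

lemma card_crossed_pair:
  assumes "finite X" and "finite Y" and "X \<union> Y \<subseteq> L \<union> H" and "L \<inter> H = {}"
    and "card X = card Y" and "card (X \<inter> L) = card (Y \<inter> L)"
  shows "card (L \<inter> X) + card (H \<inter> Y) = card X"
proof -
  have "Y = (Y \<inter> L) \<union> (H \<inter> Y)" using assms(3) by auto
  moreover have "card ((Y \<inter> L) \<union> (H \<inter> Y)) = card (Y \<inter> L) + card (H \<inter> Y)"
    using assms(2,4) by (intro card_Un_disjoint) auto
  ultimately show ?thesis using assms(5,6) by (simp add: Int_commute)
qed

text \<open>
  Suspects of known direction, with a genuine coin \<open>g\<close>. Each tilting branch should receive at
  most \<open>q = 5 ^ k\<close> of the at most \<open>5 * q\<close> suspects. With more than \<open>4 * q\<close> suspects,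
  balanced pairs fill both scales and at most \<open>q\<close> coins stay off. Otherwise
  balanced pairs leave only one or two coins, and the second scale still has room for one
  more: it is weighed against \<open>g\<close>, and at most one coin stays off. The genuine coin cannot
  be dispensed with, since one light and one heavy suspect alone are indistinguishable.
\<close>

lemma solvable_disjoint:
  assumes "L \<union> H \<subseteq> {..<N}" and "L \<inter> H = {}" and "card (L \<union> H) \<le> 5 ^ k"
    and "g < N" and "g \<notin> L \<union> H"
  shows "solvable N k L H"
  using assms
proof (induction k arbitrary: L H g)
  case 0
  have "finite (L \<union> H)" using 0 finite_subset by blast
  then have "\<forall>c \<in> L \<union> H. \<forall>d \<in> L \<union> H. c = d"
    using 0(3) card_le_Suc0_iff_eq[of "L \<union> H"] by simp
  then show ?case unfolding solvable.simps by blast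
next
  case (Suc k)
  define T where "T = L \<union> H"
  define q :: nat where "q = 5 ^ k"
  have "q \<ge> 1" by (simp add: q_def)
  have fin: "finite T" using Suc.prems(1) finite_subset unfolding T_def by blast
  have small: "card T \<le> 5 * q" using Suc.prems(3) by (simp add: T_def q_def)
  have IH: "solvable N k L' H'"
    if "L' \<subseteq> L" "H' \<subseteq> H" "card L' + card H' \<le> q" for L' H'
  proof (rule Suc.IH[of _ _ g])
    have "card (L' \<union> H') \<le> q" using that(3) card_Un_le[of L' H'] by simp
    then show "card (L' \<union> H') \<le> 5 ^ k" by (simp add: q_def)
  qed (use that Suc.prems in auto)
  show ?case
  proof (cases "T = {}")
    case True
    then show ?thesis by (intro solvable_singleton[of _ _ 0]) (simp add: T_def)
  next
    case False
    then have "card T \<ge> 1" using fin by (simp add: Suc_le_eq card_gt_0_iff)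
    \<comment> \<open>\<open>t\<close> balanced pairs are used, \<open>i\<close> on the first scale and \<open>j\<close> on the second; when there are few suspects, one or two of them remain.\<close>
    define t where "t = min (2 * q) ((card T - 1) div 2)"
    define i where "i = min q t"
    define j where "j = t - i"
    have "t \<le> 2 * q" by (simp add: t_def)
    moreover have "2 * t < card T" using \<open>card T \<ge> 1\<close> by (simp add: t_def min_def) linarith
    moreover have "i + j = t" by (simp add: i_def j_def)
    ultimately have ij: "i \<le> q" "j \<le> q" "i + j = t" "2 * i + 2 * j < card T"
      by (auto simp: i_def j_def min_def)
    obtain X Y where XY: "X \<subseteq> T" "Y \<subseteq> T" "X \<inter> Y = {}" "card X = i" "card Y = i"
      "card (X \<inter> L) = card (Y \<inter> L)"
      using exists_balanced_pair[OF fin, of i L] ij(4) by auto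
    have finXY: "finite X" "finite Y" using XY fin finite_subset by blast+
    have cardT': "card (T - (X \<union> Y)) = card T - 2 * i"
      using XY finXY by (simp add: card_Diff_subset card_Un_disjoint)
    have "2 * j < card (T - (X \<union> Y))" using ij(4) cardT' by linarith
    then obtain V W where VW: "V \<subseteq> T - (X \<union> Y)" "W \<subseteq> T - (X \<union> Y)" "V \<inter> W = {}"
      "card V = j" "card W = j" "card (V \<inter> L) = card (W \<inter> L)"
      using exists_balanced_pair[of "T - (X \<union> Y)" j L] fin by blast
    have finVW: "finite V" "finite W" using VW fin finite_subset by (metis finite_Diff)+
    define R where "R = T - (X \<union> Y \<union> V \<union> W)"
    have "R = T - (X \<union> Y) - (V \<union> W)" by (auto simp: R_def)
    then have cardR: "card R = card T - 2 * i - 2 * j"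
      using VW finVW cardT' by (simp add: card_Diff_subset card_Un_disjoint)
    have crossXY: "card (L \<inter> X) + card (H \<inter> Y) = i" "card (L \<inter> Y) + card (H \<inter> X) = i"
      using card_crossed_pair[of X Y L H] card_crossed_pair[of Y X L H] XY finXY Suc.prems(2)
      by (auto simp: T_def Un_commute)
    have crossVW: "card (L \<inter> V) + card (H \<inter> W) = j" "card (L \<inter> W) + card (H \<inter> V) = j"
      using card_crossed_pair[of V W L H] card_crossed_pair[of W V L H] VW finVW Suc.prems(2)
      by (auto simp: T_def)
    have subN: "T \<subseteq> {..<N}" using Suc.prems(1) by (simp add: T_def)
    have gT: "g \<notin> T" using Suc.prems(5) by (simp add: T_def)
    have disj_card: "card (L \<inter> Z) + card (H \<inter> Z) = card Z" if "Z \<subseteq> T" for Z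
    proof -
      have "finite Z" using that fin finite_subset by blast
      moreover have "Z = (L \<inter> Z) \<union> (H \<inter> Z)" using that by (auto simp: T_def)
      moreover have "(L \<inter> Z) \<inter> (H \<inter> Z) = {}" using Suc.prems(2) by auto
      ultimately show ?thesis
        using card_Un_disjoint[of "L \<inter> Z" "H \<inter> Z"] by simp
    qed
    show ?thesis
    proof (cases "card T \<le> 4 * q")
      case False
      then have "t = 2 * q" by (simp add: t_def)
      then have "i = q" "j = q" by (simp_all add: i_def j_def)
      then have "card R \<le> q" using cardR small by simp
      then have "card (L \<inter> R) + card (H \<inter> R) \<le> q"
        using disj_card[of R] by (simp add: R_def)
      then have "solvable N k (L \<inter> R) (H \<inter> R)" by (intro IH) simp_all
      moreover have "L - (X \<union> Y \<union> V \<union> W) = L \<inter> R" "H - (X \<union> Y \<union> V \<union> W) = H \<inter> R"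
        by (auto simp: R_def T_def)
      ultimately have rest:
        "solvable N k (L - (X \<union> Y \<union> V \<union> W)) (H - (X \<union> Y \<union> V \<union> W))"
        by (simp only:)
      show ?thesis
        by (rule solvable_by_pans[OF _ _ _ _ _ _ IH IH IH IH rest])
          (use XY VW subN crossXY crossVW ij in auto)
    next
      case True
      then have t: "t = (card T - 1) div 2" "t < 2 * q"
        using \<open>card T \<ge> 1\<close> by (auto simp: t_def)
      then have "j < q" using \<open>q \<ge> 1\<close> unfolding i_def j_def by linarith
      have "1 \<le> card R" "card R \<le> 2" using cardR t ij(3) \<open>card T \<ge> 1\<close> by linarith+
      \<comment> \<open>The coin \<open>x\<close> joins \<open>V\<close> on the left and the genuine coin \<open>g\<close> joins \<open>W\<close> on the right.\<close>
      then obtain x where x: "x \<in> R" by (metis One_nat_def card.empty ex_in_conv not_less_eq_eq zero_le)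
      have xT: "x \<in> T" "x \<notin> X \<union> Y \<union> V \<union> W" using x by (auto simp: R_def)
      let ?P = "X \<union> Y \<union> insert x V \<union> insert g W"
      have "finite R" using fin by (simp add: R_def)
      then have "card (R - {x}) \<le> 1" using x \<open>card R \<le> 2\<close> by simp
      moreover have "R - {x} \<subseteq> T" by (auto simp: R_def)
      ultimately have "card (L \<inter> (R - {x})) + card (H \<inter> (R - {x})) \<le> q"
        using disj_card[of "R - {x}"] \<open>q \<ge> 1\<close> by linarith
      then have "solvable N k (L \<inter> (R - {x})) (H \<inter> (R - {x}))" by (intro IH) simp_all
      moreover have "L - ?P = L \<inter> (R - {x})" "H - ?P = H \<inter> (R - {x})"
        using gT by (auto simp: R_def T_def)
      ultimately have rest: "solvable N k (L - ?P) (H - ?P)" by (simp only:)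
      have g: "L \<inter> insert g W = L \<inter> W" "H \<inter> insert g W = H \<inter> W" "g \<notin> W" "g \<notin> X \<union> Y"
        using gT VW XY by (auto simp: T_def)
      have "card (L \<inter> insert x V) + card (H \<inter> W) \<le> q"
        "card (L \<inter> W) + card (H \<inter> insert x V) \<le> q"
        using crossVW \<open>j < q\<close> finVW xT by (auto simp: Int_insert_right)
      then have B: "solvable N k (L \<inter> insert x V) (H \<inter> insert g W)"
        "solvable N k (L \<inter> insert g W) (H \<inter> insert x V)"
        unfolding g by (intro IH; simp)+
      show ?thesis
      proof (rule solvable_by_pans[OF _ _ _ _ _ _ IH IH B rest])
        show "(X \<union> Y) \<inter> (insert x V \<union> insert g W) = {}" using VW g xT by auto
        show "insert x V \<inter> insert g W = {}" using VW g xT gT by auto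
        show "card (insert x V) = card (insert g W)" using VW g xT finVW by simp
        show "?P \<subseteq> {..<N}" using XY VW subN xT Suc.prems(4) by auto
      qed (use XY crossXY ij in auto)
    qed
  qed
qed

text \<open>
  A genuine coin on a pan makes the number of coins even without adding a suspect.
\<close>

lemma exists_halving:
  assumes "finite X" and "g \<notin> X"
  shows "\<exists>A1 A2. A1 \<inter> A2 = {} \<and> card A1 = card A2 \<and>
    X \<subseteq> A1 \<union> A2 \<and> A1 \<union> A2 \<subseteq> insert g X"
proof -
  define X' where "X' = (if even (card X) then X else insert g X)"
  have X': "finite X'" "even (card X')" "X \<subseteq> X'" "X' \<subseteq> insert g X"
    using assms by (auto simp: X'_def)
  obtain A where A: "A \<subseteq> X'" "card A = card X' div 2"
    by (meson div_le_dividend obtain_subset_with_card_n)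
  then have "card (X' - A) = card X' div 2"
    using X'(1,2) finite_subset[OF A(1) X'(1)] by (auto simp: card_Diff_subset)
  then show ?thesis
    using A X'(3,4) by (intro exI[of _ A] exI[of _ "X' - A"]) auto
qed

text \<open>
  Coins of unknown direction, with two genuine coins \<open>g\<close> and \<open>h\<close>. Each scale takes up to
  \<open>q = 5 ^ k\<close> unknown coins, an odd number, and one genuine coin makes
  it even; hence a genuine coin is kept for each scale. If a scale tilts, its unknown coins become
  suspects of known direction, and the other branch leaves at most \<open>(q + 1) / 2\<close> unknown
  coins, because \<open>(5 * q + 1) / 2 - 2 * q = (q + 1) / 2\<close>.
\<close>

lemma solvable_unknown:
  assumes "U \<subseteq> {..<N}" and "2 * card U \<le> 5 ^ k + 1"
    and "g < N" and "g \<notin> U" and "h < N" and "h \<notin> U" and "g \<noteq> h"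
  shows "solvable N k U U"
  using assms
proof (induction k arbitrary: U)
  case 0
  have "finite U" using 0 finite_subset by blast
  then have "\<forall>c \<in> U. \<forall>d \<in> U. c = d"
    using 0(2) card_le_Suc0_iff_eq[of U] by simp
  then show ?case unfolding solvable.simps by blast
next
  case (Suc k)
  define q :: nat where "q = 5 ^ k"
  have fin: "finite U" using Suc.prems(1) finite_subset by blast
  have small: "2 * card U \<le> 5 * q + 1" using Suc.prems(2) by (simp add: q_def)
  obtain X where X: "X \<subseteq> U" "card X = min q (card U)"
    by (meson min.cobounded2 obtain_subset_with_card_n)
  have finX: "finite X" using X fin finite_subset by blast
  obtain Y where Y: "Y \<subseteq> U - X" "card Y = min q (card (U - X))"
    by (meson min.cobounded2 obtain_subset_with_card_n)
  have finY: "finite Y" using Y fin finite_subset by (metis finite_Diff)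
  have "g \<notin> X" "h \<notin> Y" using X Y Suc.prems by auto
  obtain A1 A2 where A: "A1 \<inter> A2 = {}" "card A1 = card A2" "X \<subseteq> A1 \<union> A2" "A1 \<union> A2 \<subseteq> insert g X"
    using exists_halving[OF finX \<open>g \<notin> X\<close>] by blast
  obtain B1 B2 where B: "B1 \<inter> B2 = {}" "card B1 = card B2" "Y \<subseteq> B1 \<union> B2" "B1 \<union> B2 \<subseteq> insert h Y"
    using exists_halving[OF finY \<open>h \<notin> Y\<close>] by blast
  have onscale: "solvable N k (U \<inter> C) (U \<inter> D)"
    if "C \<inter> D = {}" "U \<inter> C \<union> U \<inter> D \<subseteq> Z" "Z \<subseteq> U" "card Z \<le> q" for C D Z
  proof (rule solvable_disjoint[of _ _ _ _ g])
    have "card (U \<inter> C \<union> U \<inter> D) \<le> card Z"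
      using that fin by (meson card_mono finite_subset)
    then show "card (U \<inter> C \<union> U \<inter> D) \<le> 5 ^ k" using that by (simp add: q_def)
  qed (use that Suc.prems in auto)
  have UA: "U \<inter> A1 \<union> U \<inter> A2 \<subseteq> X" and UB: "U \<inter> B1 \<union> U \<inter> B2 \<subseteq> Y"
    using A(4) B(4) Suc.prems by auto
  have rest: "solvable N k (U - (A1 \<union> A2 \<union> B1 \<union> B2)) (U - (A1 \<union> A2 \<union> B1 \<union> B2))"
  proof (rule Suc.IH)
    have "U - (A1 \<union> A2 \<union> B1 \<union> B2) = U - X - Y"
      using A(3) B(3) UA UB by auto
    moreover have "card (U - X - Y) = card U - card X - card Y"
      using X Y finX finY by (simp add: card_Diff_subset)
    moreover have "card (U - X) = card U - card X"
      using X finX by (simp add: card_Diff_subset)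
    ultimately show "2 * card (U - (A1 \<union> A2 \<union> B1 \<union> B2)) \<le> 5 ^ k + 1"
      using X(2) Y(2) small by (auto simp: q_def min_def split: if_splits)
  qed (use Suc.prems in auto)
  show ?case
  proof (rule solvable_by_pans[OF _ _ _ _ _ _ onscale[of _ _ X] onscale[of _ _ X]
        onscale[of _ _ Y] onscale[of _ _ Y] rest])
    have "(insert g X) \<inter> (insert h Y) = {}" using X Y Suc.prems by auto
    then show "(A1 \<union> A2) \<inter> (B1 \<union> B2) = {}" using A(4) B(4) by blast
    show "A1 \<union> A2 \<union> B1 \<union> B2 \<subseteq> {..<N}" using A(4) B(4) X Y Suc.prems by blast
  qed (use A B X Y UA UB in auto)
qed

text \<open>
  The first weighing puts \<open>a\<close> coins on each pan of the first scale and \<open>b\<close> on each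
  pan of the second. Both numbers are as large as the odd capacity \<open>q = 5 ^ k\<close>
  and the supply of coins permit, except that the first scale must leave a coin aside, since otherwise no genuine coin
  would be available when it tilts. The coins off the first scale are genuine if that scale tilts;
  the coins on it are genuine otherwise.
\<close>

lemma solvable_all:
  assumes "3 \<le> N" and "1 \<le> k" and "2 * N + 3 \<le> 5 ^ Suc k"
  shows "solvable N (Suc k) {..<N} {..<N}"
proof -
  define q :: nat where "q = 5 ^ k"
  have "(5::nat) ^ 1 \<le> 5 ^ k" using \<open>1 \<le> k\<close> by (intro power_increasing) auto
  then have "q \<ge> 5" by (simp add: q_def)
  have "odd q" by (simp add: q_def)
  have small: "2 * N + 3 \<le> 5 * q" using assms(3) by (simp add: q_def)
  define a where "a = min ((q - 1) div 2) ((N - 1) div 2)"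
  define b where "b = min ((q - 1) div 2) ((N - 2 * a) div 2)"
  have a: "1 \<le> a" "2 * a < N" "2 * a \<le> q"
    using \<open>q \<ge> 5\<close> assms(1) by (auto simp: a_def)
  have b: "2 * a + 2 * b \<le> N" "2 * b \<le> q"
    using a by (auto simp: b_def)
  have rest: "2 * (N - (2 * a + 2 * b)) \<le> q + 1"
  proof -
    obtain r where q: "q = 2 * r + 1" using \<open>odd q\<close> by (rule oddE)
    \<comment> \<open>Either the second scale takes every remaining pair, or both scales are full.\<close>
    show ?thesis
    proof (cases "b = (N - 2 * a) div 2")
      case True
      then show ?thesis using \<open>q \<ge> 5\<close> by linarith
    next
      case False
      then have eq_b: "b = (q - 1) div 2" and "b < (N - 2 * a) div 2"
        unfolding b_def by linarith+
      then have "a \<noteq> (N - 1) div 2" using \<open>q \<ge> 5\<close> by linarith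
      then have "a = (q - 1) div 2" by (auto simp: a_def min_def split: if_splits)
      then show ?thesis using eq_b q small by simp
    qed
  qed
  let ?A1 = "{..<a}" and ?A2 = "{a..<2 * a}"
    and ?B1 = "{2 * a..<2 * a + b}" and ?B2 = "{2 * a + b..<2 * a + 2 * b}"
  have subset: "?A1 \<union> ?A2 \<union> ?B1 \<union> ?B2 \<subseteq> {..<N}" using a b by auto
  then have int: "{..<N} \<inter> ?A1 = ?A1" "{..<N} \<inter> ?A2 = ?A2"
    "{..<N} \<inter> ?B1 = ?B1" "{..<N} \<inter> ?B2 = ?B2"
    by auto
  have on: "solvable N k C D"
    if "C \<union> D = {l..<u}" "C \<inter> D = {}" "u \<le> N" "u - l \<le> q" "0 < l \<or> u < N" for C D l u
  proof (rule solvable_disjoint)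
    show "(if 0 < l then 0 else N - 1) < N" using assms(1) by simp
    show "(if 0 < l then 0 else N - 1) \<notin> C \<union> D" unfolding that(1) using that(5) by auto
    show "C \<union> D \<subseteq> {..<N}" unfolding that(1) using that(3) by auto
    show "card (C \<union> D) \<le> 5 ^ k" unfolding that(1) using that(4) by (simp add: q_def)
  qed (rule that(2))
  have un: "?A1 \<union> ?A2 = {0..<2 * a}" "?A2 \<union> ?A1 = {0..<2 * a}"
    "?B1 \<union> ?B2 = {2 * a..<2 * a + 2 * b}" "?B2 \<union> ?B1 = {2 * a..<2 * a + 2 * b}"
    by auto
  have dj: "?A1 \<inter> ?A2 = {}" "?A2 \<inter> ?A1 = {}" "?B1 \<inter> ?B2 = {}" "?B2 \<inter> ?B1 = {}"
    "(?A1 \<union> ?A2) \<inter> (?B1 \<union> ?B2) = {}"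
    by auto
  have A: "solvable N k ?A1 ?A2" "solvable N k ?A2 ?A1"
    using on[OF un(1) dj(1)] on[OF un(2) dj(2)] a by simp_all
  have B: "solvable N k ?B1 ?B2" "solvable N k ?B2 ?B1"
    using on[OF un(3) dj(3)] on[OF un(4) dj(4)] a b by simp_all
  have "{..<N} - (?A1 \<union> ?A2 \<union> ?B1 \<union> ?B2) = {2 * a + 2 * b..<N}" by auto
  moreover have "solvable N k {2 * a + 2 * b..<N} {2 * a + 2 * b..<N}"
    using rest a assms(1) by (intro solvable_unknown[of _ _ _ 0 1]) (auto simp: q_def)
  ultimately have off: "solvable N k ({..<N} - (?A1 \<union> ?A2 \<union> ?B1 \<union> ?B2))
      ({..<N} - (?A1 \<union> ?A2 \<union> ?B1 \<union> ?B2))"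
    by simp
  show ?thesis
    by (rule solvable_by_pans[OF subset dj(1,3,5) _ _ _ _ _ _ off]) (simp_all only: int A B, simp_all)
qed

section \<open>The minimum number of minutes\<close>

text \<open>
  A heavy fake coin 0 and a light fake coin 1 can give the coins the same weights, 2 and 1.
\<close>

lemma not_can_find_two: "\<not> can_find_within 2 m"
proof
  assume "can_find_within 2 m"
  then obtain \<sigma> g where
    find: "\<And>f a b. \<lbrakk>f < 2; a > 0; b > 0; a \<noteq> b\<rbrakk> \<Longrightarrow> g (run 2 \<sigma> (coin_weights f a b) m) = f"
    unfolding can_find_within_def by blast
  have "reading_of 2 (coin_weights 0 1 2) p = reading_of 2 (coin_weights 1 2 1) p" for p
  proof -
    have "(\<Sum>c\<in>pan 2 p s d. coin_weights 0 1 2 c) = (\<Sum>c\<in>pan 2 p s d. coin_weights 1 2 1 c)" for s d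
      by (rule sum.cong) (auto simp: pan_def coin_weights_def)
    then show ?thesis by (simp add: reading_of_def fun_eq_iff)
  qed
  then have "run 2 \<sigma> (coin_weights 0 1 2) m = run 2 \<sigma> (coin_weights 1 2 1) m"
    by (induction m) simp_all
  then show False using find[of 0 1 2] find[of 1 2 1] by simp
qed

lemma can_find_within_0_iff: "can_find_within N 0 \<longleftrightarrow> N \<le> 1"
proof
  assume "can_find_within N 0"
  then obtain c where "{..<N} \<subseteq> {c}" by (auto simp: can_find_within_iff_solvable)
  then have "card {..<N} \<le> card {c}" by (intro card_mono) auto
  then show "N \<le> 1" by simp
next
  assume "N \<le> 1"
  then have "{..<N} \<subseteq> {0}" by auto
  then show "can_find_within N 0" by (auto simp: can_find_within_iff_solvable)
qed

lemma can_find_within_imp_le: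
  assumes "can_find_within N n" and "n \<ge> 1"
  shows "2 * N + 3 \<le> 5 ^ n"
  using assms solvable_all_le[of N "n - 1"] by (simp add: can_find_within_iff_solvable)

lemma can_find_within_if_le:
  assumes "2 * N + 3 \<le> 5 ^ n" and "N \<ge> 3"
  shows "can_find_within N n"
proof -
  have "n \<ge> 2"
  proof (rule ccontr)
    assume "\<not> n \<ge> 2"
    then have "n = 0 \<or> n = 1" by auto
    then show False using assms by auto
  qed
  then obtain k where "n = Suc k" "k \<ge> 1" by (cases n) auto
  then show ?thesis using assms solvable_all by (simp add: can_find_within_iff_solvable)
qed

text \<open>
  For three or more coins the condition for success within \<open>n\<close> minutes is exact for every
  \<open>n\<close>, so the minimum lies where \<open>2 * N + 3\<close> passes from one power of five to the
  next. A single coin needs no weighing, hence no \<open>n \<ge> 2\<close> is its minimum; the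
  inequalities agree because \<open>2 * 1 + 3 = 5\<close>.
\<close>

lemma min_minutes_iff:
  assumes "N \<ge> 1" and "N \<noteq> 2" and "n \<ge> 2"
  shows "min_minutes N n \<longleftrightarrow> 5 ^ (n - 1) < 2 * N + 3 \<and> 2 * N + 3 \<le> 5 ^ n"
proof (cases "N = 1")
  case True
  have "(5::nat) ^ 1 \<le> 5 ^ (n - 1)" using assms(3) by (intro power_increasing) auto
  moreover have "\<not> min_minutes N n"
    using True assms(3) unfolding min_minutes_def
    by (metis can_find_within_0_iff le_refl less_le_trans pos2)
  ultimately show ?thesis using True by simp
next
  case False
  then have "N \<ge> 3" using assms by simp
  show ?thesis
  proof
    assume "min_minutes N n"
    then have "can_find_within N n" "\<not> can_find_within N (n - 1)"
      using assms(3) by (auto simp: min_minutes_def)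
    then have "2 * N + 3 \<le> 5 ^ n" "\<not> 2 * N + 3 \<le> 5 ^ (n - 1)"
      using can_find_within_imp_le[of N n] can_find_within_if_le[of N "n - 1"] \<open>N \<ge> 3\<close> assms(3)
      by auto
    then show "5 ^ (n - 1) < 2 * N + 3 \<and> 2 * N + 3 \<le> 5 ^ n" by simp
  next
    assume bounds: "5 ^ (n - 1) < 2 * N + 3 \<and> 2 * N + 3 \<le> 5 ^ n"
    have "\<not> can_find_within N m" if "m < n" for m
    proof (cases "m = 0")
      case True
      then show ?thesis using can_find_within_0_iff \<open>N \<ge> 3\<close> by auto
    next
      case False
      have "(5::nat) ^ m \<le> 5 ^ (n - 1)" using that by (intro power_increasing) auto
      then have "\<not> 2 * N + 3 \<le> 5 ^ m" using bounds by linarith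
      then show ?thesis using can_find_within_imp_le[of N m] False by auto
    qed
    then show "min_minutes N n"
      using can_find_within_if_le bounds \<open>N \<ge> 3\<close> by (auto simp: min_minutes_def)
  qed
qed

theorem theorem5:
  fixes N :: nat
  assumes "N \<ge> 1"
  shows "(N = 2 \<longrightarrow> (\<forall>m. \<not> can_find_within N m)) \<and>
         (N \<noteq> 2 \<longrightarrow> (\<forall>n\<ge>2. min_minutes N n \<longleftrightarrow>
            ((5::real) ^ (n - 1) - 3) / 2 < real N \<and> real N \<le> ((5::real) ^ n - 3) / 2))"
proof -
  have "((5::real) ^ m - 3) / 2 < real N \<longleftrightarrow> 5 ^ m < 2 * N + 3" for m
  proof -
    have "5 ^ m < 2 * N + 3 \<longleftrightarrow> real (5 ^ m) < real (2 * N + 3)" by (simp only: of_nat_less_iff)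
    then show ?thesis by (simp add: field_simps)
  qed
  moreover have "real N \<le> ((5::real) ^ m - 3) / 2 \<longleftrightarrow> 2 * N + 3 \<le> 5 ^ m" for m
  proof -
    have "2 * N + 3 \<le> 5 ^ m \<longleftrightarrow> real (2 * N + 3) \<le> real (5 ^ m)" by (simp only: of_nat_le_iff)
    then show ?thesis by (simp add: field_simps)
  qed
  ultimately show ?thesis
    using not_can_find_two min_minutes_iff[OF assms] by auto
qed

end
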